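(* Let $n\ge 3$, let $U$ and $D$ be disjoint subsets of $[2,n-1]$ and $\pi\in\mathfrak S_n$. The following are equivalent: (a) $\pi$ possesses a reduced word that is accepted simultaneously by $\mathbb U(j)$ for every $j\in U$ and by $\mathbb D(j)$ for every $j\in D$; (b) $\pi$ avoids the patterns $jki$ for every $j\in U$ and $kij$ for every $j\in D$ (with $i<j<k$).
   Context: $\mathfrak S_n$ is generated by $s_a=(a\ a{+}1)$, $a\in[n-1]$; a word $s_{a_1}\cdots s_{a_\ell}$ represents $\pi=s_{a_1}\circ\cdots\circ s_{a_\ell}$ (composition of maps), written in one-line notation $\pi(1)\cdots\pi(n)$; it is reduced if $\ell$ is minimal among words for $\pi$. For fixed $j$, $\pi$ avoids $jki$ (resp. $kij$) if there are no $i<j<k$ with $j,k,i$ (resp. $k,i,j$) appearing in this order in $\pi(1)\cdots\pi(n)$. Automata read words left to right over $\{s_1,\dots,s_{n-1}\}$; unspecified transitions are loops; a word is accepted iff its run never enters a dead state (dead states absorbing and rejecting, all other states accepting). $\mathbb U(j)$: states $H_j$ (initial), $H_{j+1},\dots,H_n$, ill states $I_j,\dots,I_{n-1}$, dead; for $m\in[j,n-1]$: $H_m\xrightarrow{s_m}H_{m+1}$, $H_m\xrightarrow{s_{m-1}}I_m$, $I_m\xrightarrow{s_m}$ dead; $H_n$ loops on every letter. $\mathbb D(j)$: states $G_j$ (initial), $G_{j-1},\dots,G_1$, ill states $J_j,\dots,J_2$, dead; for $m\in[2,j]$: $G_m\xrightarrow{s_{m-1}}G_{m-1}$, $G_m\xrightarrow{s_m}J_m$,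 $J_m\xrightarrow{s_{m-1}}$ dead; $G_1$ loops on every letter. *)

theory Defs
  imports Main "HOL-Combinatorics.Permutations"
begin

text \<open>
  Elements of the symmetric group on \<open>{1..n}\<close> are functions \<open>\<pi> :: nat \<Rightarrow> nat\<close> with
  \<open>\<pi> permutes {1..n}\<close>; one-line notation is \<open>\<pi> 1, \<dots>, \<pi> n\<close>. The generator \<open>s\<^sub>a = (a a+1)\<close>
  is \<open>transpose a (Suc a)\<close>, and a word in the generators is the list of its indices.
\<close>

definition words :: "nat \<Rightarrow> nat list set" where
  "words n = lists {1..n - 1}"

definition word_perm :: "nat list \<Rightarrow> nat \<Rightarrow> nat" where
  "word_perm w = foldr (\<lambda>a p. transpose a (Suc a) \<circ> p) w id"

definition reduced_word :: "nat \<Rightarrow> (nat \<Rightarrow> nat) \<Rightarrow> nat list \<Rightarrow> bool" where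
  "reduced_word n \<pi> w \<longleftrightarrow>
     w \<in> words n \<and> word_perm w = \<pi> \<and>
     (\<forall>v \<in> words n. word_perm v = \<pi> \<longrightarrow> length w \<le> length v)"

text \<open>
  The states \<open>H\<^sub>m\<close> of \<open>U(j)\<close> and \<open>G\<^sub>m\<close> of \<open>D(j)\<close> are both encoded as \<open>Healthy m\<close>, the states
  \<open>I\<^sub>m\<close> and \<open>J\<^sub>m\<close> as \<open>Ill m\<close>. Index values outside the range of the automaton at hand do not
  correspond to states and are unreachable from its initial state \<open>Healthy j\<close>.
\<close>

datatype state = Healthy nat | Ill nat | Dead

text \<open>The letter \<open>s\<^bsub>m-1\<^esub>\<close> is recognised by \<open>Suc a = m\<close>, avoiding truncated subtraction.\<close>

fun U_step :: "nat \<Rightarrow> nat \<Rightarrow> state \<Rightarrow> nat \<Rightarrow> state" where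
  "U_step n j (Healthy m) a =
     (if m \<in> {j..<n} \<and> a = m then Healthy (Suc m)
      else if m \<in> {j..<n} \<and> Suc a = m then Ill m
      else Healthy m)"
| "U_step n j (Ill m) a = (if m \<in> {j..<n} \<and> a = m then Dead else Ill m)"
| "U_step n j Dead a = Dead"

fun D_step :: "nat \<Rightarrow> state \<Rightarrow> nat \<Rightarrow> state" where
  "D_step j (Healthy m) a =
     (if m \<in> {2..j} \<and> Suc a = m then Healthy (m - 1)
      else if m \<in> {2..j} \<and> a = m then Ill m
      else Healthy m)"
| "D_step j (Ill m) a = (if m \<in> {2..j} \<and> Suc a = m then Dead else Ill m)"
| "D_step j Dead a = Dead"

definition never_dead :: "(state \<Rightarrow> nat \<Rightarrow> state) \<Rightarrow> state \<Rightarrow> nat list \<Rightarrow> bool" where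
  "never_dead \<delta> q w \<longleftrightarrow> (\<forall>k \<le> length w. foldl \<delta> q (take k w) \<noteq> Dead)"

definition U_accepts :: "nat \<Rightarrow> nat \<Rightarrow> nat list \<Rightarrow> bool" where
  "U_accepts n j w \<longleftrightarrow> never_dead (U_step n j) (Healthy j) w"

definition D_accepts :: "nat \<Rightarrow> nat list \<Rightarrow> bool" where
  "D_accepts j w \<longleftrightarrow> never_dead (D_step j) (Healthy j) w"

definition appear_in_order :: "nat \<Rightarrow> (nat \<Rightarrow> nat) \<Rightarrow> nat \<Rightarrow> nat \<Rightarrow> nat \<Rightarrow> bool" where
  "appear_in_order n \<pi> x y z \<longleftrightarrow>
     (\<exists>p q r. 1 \<le> p \<and> p < q \<and> q < r \<and> r \<le> n \<and> \<pi> p = x \<and> \<pi> q = y \<and> \<pi> r = z)"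

definition avoids_jki :: "nat \<Rightarrow> (nat \<Rightarrow> nat) \<Rightarrow> nat \<Rightarrow> bool" where
  "avoids_jki n \<pi> j \<longleftrightarrow> \<not> (\<exists>i k. i < j \<and> j < k \<and> appear_in_order n \<pi> j k i)"

definition avoids_kij :: "nat \<Rightarrow> (nat \<Rightarrow> nat) \<Rightarrow> nat \<Rightarrow> bool" where
  "avoids_kij n \<pi> j \<longleftrightarrow> \<not> (\<exists>i k. i < j \<and> j < k \<and> appear_in_order n \<pi> k i j)"

end

theory Submission imports Defs
begin

text \<open>
  Read a reduced word from the left: peeling off the first letter \<open>s\<^sub>a\<close> exchanges the values \<open>a\<close>
  and \<open>a+1\<close>, where \<open>a+1\<close> stands before \<open>a\<close>. A healthy state \<open>H\<^sub>m\<close> accepts exactly the remaining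
  permutations that avoid \<open>m k i\<close>, and an ill state \<open>I\<^sub>m\<close> those that keep \<open>{1..m}\<close> stable; dually for
  \<open>D(j)\<close>. These conditions are pulled back along every letter of a reduced word, which gives (a)
  to (b). They are pushed forward along \<open>s\<^sub>a\<close> unless \<open>H\<^bsub>a+1\<^esub>\<close> is a current state and some \<open>k > a+1\<close>
  precedes \<open>a+1\<close>, or \<open>G\<^sub>a\<close> is a current state and some \<open>i < a\<close> follows \<open>a\<close>. If every descent were
  obstructed, there would be neighbouring descents \<open>a < b\<close> obstructed by \<open>H\<^bsub>a+1\<^esub>\<close> and \<open>G\<^sub>b\<close>
  respectively. The values \<open>a+1, \<dots>, b\<close> then occur in increasing order, and disjointness gives
  \<open>a+1 < b\<close>, so \<open>a+1, b\<close> and a smaller value after \<open>b\<close> form a forbidden pattern.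

  Everything is expressed through the inverse permutation \<open>\<tau>\<close>, so that \<open>\<tau> x\<close> is the position of
  the value \<open>x\<close>.
\<close>

section \<open>Inversions and reduced words\<close>

text \<open>With \<open>\<tau>\<close> the inverse of a permutation, these are its inversions
  recorded by values, so their number is its Coxeter length.\<close>

definition inversions :: "nat \<Rightarrow> (nat \<Rightarrow> nat) \<Rightarrow> (nat \<times> nat) set" where
  "inversions n \<tau> = {(x, y). 1 \<le> x \<and> x < y \<and> y \<le> n \<and> \<tau> y < \<tau> x}"

lemma finite_inversions [simp]: "finite (inversions n \<tau>)"
  by (rule finite_subset[of _ "{1..n} \<times> {1..n}"]) (auto simp: inversions_def)

text \<open>Exchanging \<open>a\<close> and \<open>Suc a\<close> alters the relative order of no
  pair of values but these two, so it matches all other inversions bijectively.\<close>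

lemma card_inversions_descent:
  assumes "1 \<le> a" "a < n" "\<tau> (Suc a) < \<tau> a"
  shows "card (inversions n \<tau>) = Suc (card (inversions n (\<tau> \<circ> transpose a (Suc a))))"
proof -
  let ?t = "transpose a (Suc a)"
  let ?f = "map_prod ?t ?t"
  have inv: "?f (?f z) = z" for z
    by (cases z) simp
  have "bij_betw ?f (inversions n \<tau> - {(a, Suc a)}) (inversions n (\<tau> \<circ> ?t))"
  proof (rule bij_betw_byWitness[where f' = ?f])
    show "?f ` (inversions n \<tau> - {(a, Suc a)}) \<subseteq> inversions n (\<tau> \<circ> ?t)"
      using assms by (auto simp: inversions_def) (auto simp: transpose_def split: if_splits)
    show "?f ` inversions n (\<tau> \<circ> ?t) \<subseteq> inversions n \<tau> - {(a, Suc a)}"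
      using assms by (auto simp: inversions_def) (auto simp: transpose_def split: if_splits)
  qed (use inv in auto)
  then have "card (inversions n \<tau> - {(a, Suc a)}) = card (inversions n (\<tau> \<circ> ?t))"
    by (rule bij_betw_same_card)
  moreover have "(a, Suc a) \<in> inversions n \<tau>"
    using assms by (auto simp: inversions_def)
  ultimately show ?thesis
    by (metis card_Suc_Diff1 finite_inversions)
qed

lemma card_inversions_ascent:
  assumes "1 \<le> a" "a < n" "\<tau> a < \<tau> (Suc a)"
  shows "card (inversions n (\<tau> \<circ> transpose a (Suc a))) = Suc (card (inversions n \<tau>))"
  using card_inversions_descent[of a n "\<tau> \<circ> transpose a (Suc a)"] assms
  by (simp add: comp_assoc)

lemma descent_between:
  fixes \<tau> :: "nat \<Rightarrow> nat"
  assumes "x < y" "\<tau> y < \<tau> x"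
  shows "\<exists>c. x \<le> c \<and> c < y \<and> \<tau> (Suc c) < \<tau> c"
proof (rule ccontr)
  assume "\<not> ?thesis"
  then have mono_step: "\<tau> c \<le> \<tau> (Suc c)" if "x \<le> c" "c < y" for c
    using that by (meson not_le)
  have "z \<le> y \<longrightarrow> \<tau> x \<le> \<tau> z" if "x \<le> z" for z
    using that
  proof (induction z rule: dec_induct)
    case (step z)
    then show ?case using mono_step[of z] by linarith
  qed simp
  from this[of y] show False
    using assms by simp
qed

lemma permutes_no_descent_imp_id:
  assumes "\<tau> permutes {1..n}"
    and "\<And>a. 1 \<le> a \<Longrightarrow> a < n \<Longrightarrow> \<not> \<tau> (Suc a) < \<tau> a"
  shows "\<tau> = id"
\<comment> \<open>A permutation that moves nothing below itself is \<open>id\<close>; without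
  descents \<open>\<tau>\<close> increases strictly from a first value of at least 1.\<close>
proof (rule permutes_natset_ge[OF assms(1)], rule ballI)
  fix i assume "i \<in> {1..n}"
  then have "1 \<le> i" by simp
  then show "i \<le> \<tau> i" using \<open>i \<in> {1..n}\<close>
  proof (induction i rule: dec_induct)
    case base
    then show ?case using permutes_in_image[OF assms(1), of 1] by simp
  next
    case (step i)
    have "\<tau> i \<noteq> \<tau> (Suc i)"
      using permutes_inj[OF assms(1)] by (simp add: inj_eq)
    then show ?case using step assms(2)[of i] by force
  qed
qed

section \<open>Words in the generators and their length\<close>

lemma transpose_permutes_letter:
  assumes "1 \<le> a" "a < n"
  shows "transpose a (Suc a) permutes {1..n}"
  by (rule permutes_swap_id) (use assms in auto)

text \<open>\<open>s_a\<close> moves values only across the cut between \<open>a\<close> and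
  \<open>Suc a\<close>. The cut after \<open>m\<close> is the one of \<open>Ill m\<close> in
  \<open>U_safe\<close>, the cut before \<open>m\<close> the one in \<open>D_safe\<close>;
  \<open>Healthy m\<close> involves both.\<close>

lemma transpose_Suc_order:
  "a \<noteq> m \<Longrightarrow> transpose a (Suc a) x \<le> m \<longleftrightarrow> x \<le> m"
  "a \<noteq> m \<Longrightarrow> m < transpose a (Suc a) x \<longleftrightarrow> m < x"
  "Suc a \<noteq> m \<Longrightarrow> transpose a (Suc a) x < m \<longleftrightarrow> x < m"
  "Suc a \<noteq> m \<Longrightarrow> m \<le> transpose a (Suc a) x \<longleftrightarrow> m \<le> x"
  by (auto simp: transpose_def)

lemma word_perm_Nil [simp]: "word_perm [] = id"
  by (simp add: word_perm_def)

lemma word_perm_Cons [simp]: "word_perm (a # w) = transpose a (Suc a) \<circ> word_perm w"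
  by (simp add: word_perm_def)

lemma words_Nil [simp]: "[] \<in> words n"
  by (simp add: words_def)

lemma words_Cons [simp]: "a # w \<in> words n \<longleftrightarrow> 1 \<le> a \<and> a < n \<and> w \<in> words n"
  by (auto simp: words_def)

lemma word_perm_permutes: "w \<in> words n \<Longrightarrow> word_perm w permutes {1..n}"
proof (induction w)
  case Nil
  show ?case by (simp only: word_perm_Nil permutes_id)
next
  case (Cons a w)
  then show ?case
    unfolding word_perm_Cons by (intro permutes_compose transpose_permutes_letter) auto
qed

lemma inv_word_perm_Cons:
  assumes "w \<in> words n"
  shows "inv (word_perm (a # w)) = inv (word_perm w) \<circ> transpose a (Suc a)"
  using o_inv_distrib[OF bij_transpose permutes_bij[OF word_perm_permutes[OF assms]]]
  by simp

lemma inversions_id [simp]: "inversions n id = {}"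
  by (auto simp: inversions_def)

text \<open>Prepending a letter changes the inversion number by exactly one.\<close>

lemma card_inversions_le_length:
  "w \<in> words n \<Longrightarrow> card (inversions n (inv (word_perm w))) \<le> length w"
proof (induction w)
  case (Cons a w)
  let ?\<tau> = "inv (word_perm w)"
  have "inj ?\<tau>"
    using Cons.prems by (auto intro: permutes_inj permutes_inv word_perm_permutes)
  then have "?\<tau> a < ?\<tau> (Suc a) \<or> ?\<tau> (Suc a) < ?\<tau> a"
    by (meson inj_eq n_not_Suc_n nat_neq_iff)
  then have le: "card (inversions n (?\<tau> \<circ> transpose a (Suc a))) \<le> Suc (card (inversions n ?\<tau>))"
    using card_inversions_descent[of a n ?\<tau>] card_inversions_ascent[of a n ?\<tau>] Cons.prems
    by auto
  have "inv (word_perm (a # w)) = ?\<tau> \<circ> transpose a (Suc a)"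
    using Cons.prems by (intro inv_word_perm_Cons[of w n]) simp
  moreover have "card (inversions n ?\<tau>) \<le> length w"
    using Cons by simp
  ultimately show ?case
    using le by (simp only: list.size)
qed simp

text \<open>If the length bound is attained, the first letter must create an inversion, since
  otherwise \<open>w\<close> would be shorter than its own bound. Equality passes to
  \<open>w\<close>, which drives the inductions over reduced words.\<close>

lemma first_letter_descent:
  assumes "a # w \<in> words n"
    and "length (a # w) = card (inversions n (inv (word_perm (a # w))))"
  shows "inv (word_perm (a # w)) (Suc a) < inv (word_perm (a # w)) a"
    and "length w = card (inversions n (inv (word_perm w)))"
proof -
  let ?\<tau> = "inv (word_perm w)"
  have \<tau>: "inv (word_perm (a # w)) = ?\<tau> \<circ> transpose a (Suc a)"
    using assms(1) by (simp add: inv_word_perm_Cons[of _ n] del: word_perm_Cons)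
  have le: "card (inversions n ?\<tau>) \<le> length w"
    using assms(1) by (simp add: card_inversions_le_length)
  have inj: "inj ?\<tau>"
    using assms(1) by (auto intro: permutes_inj permutes_inv word_perm_permutes)
  have asc: "?\<tau> a < ?\<tau> (Suc a)"
  proof (rule ccontr)
    assume "\<not> ?thesis"
    then have "?\<tau> (Suc a) < ?\<tau> a"
      using inj by (metis inj_eq n_not_Suc_n nat_neq_iff)
    then show False
      using card_inversions_descent[of a n ?\<tau>] assms le \<tau> by simp
  qed
  then show "inv (word_perm (a # w)) (Suc a) < inv (word_perm (a # w)) a"
    unfolding \<tau> by simp
  show "length w = card (inversions n ?\<tau>)"
    using card_inversions_ascent[of a n ?\<tau>] asc assms \<tau> by simp
qed

section \<open>The permutations accepted from a given state\<close>

fun U_safe :: "nat \<Rightarrow> (nat \<Rightarrow> nat) \<Rightarrow> state \<Rightarrow> bool" where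
  "U_safe n \<tau> (Healthy m) \<longleftrightarrow>
     (\<forall>i k. 1 \<le> i \<and> i < m \<and> m < k \<and> k \<le> n \<longrightarrow> \<not> (\<tau> m < \<tau> k \<and> \<tau> k < \<tau> i))"
| "U_safe n \<tau> (Ill m) \<longleftrightarrow> (\<forall>i k. 1 \<le> i \<and> i \<le> m \<and> m < k \<and> k \<le> n \<longrightarrow> \<tau> i < \<tau> k)"
| "U_safe n \<tau> Dead \<longleftrightarrow> False"

text \<open>The cut of \<open>Ill m\<close> lies before \<open>m\<close>, one lower than in
  \<open>U_safe\<close>, because the fatal letter is now \<open>s_{m-1}\<close>, the generator that
  moves \<open>{1..m - 1}\<close>.\<close>

fun D_safe :: "nat \<Rightarrow> (nat \<Rightarrow> nat) \<Rightarrow> state \<Rightarrow> bool" where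
  "D_safe n \<tau> (Healthy m) \<longleftrightarrow>
     (\<forall>i k. 1 \<le> i \<and> i < m \<and> m < k \<and> k \<le> n \<longrightarrow> \<not> (\<tau> k < \<tau> i \<and> \<tau> i < \<tau> m))"
| "D_safe n \<tau> (Ill m) \<longleftrightarrow> (\<forall>i k. 1 \<le> i \<and> i < m \<and> m \<le> k \<and> k \<le> n \<longrightarrow> \<tau> i < \<tau> k)"
| "D_safe n \<tau> Dead \<longleftrightarrow> False"

fun U_state :: "nat \<Rightarrow> nat \<Rightarrow> state \<Rightarrow> bool" where
  "U_state n j (Healthy m) \<longleftrightarrow> j \<le> m \<and> m \<le> n"
| "U_state n j (Ill m) \<longleftrightarrow> j \<le> m \<and> m < n"
| "U_state n j Dead \<longleftrightarrow> True"

fun D_state :: "nat \<Rightarrow> state \<Rightarrow> bool" where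
  "D_state j (Healthy m) \<longleftrightarrow> 1 \<le> m \<and> m \<le> j"
| "D_state j (Ill m) \<longleftrightarrow> 2 \<le> m \<and> m \<le> j"
| "D_state j Dead \<longleftrightarrow> True"

section \<open>Transport of safety along a letter\<close>

lemma U_state_step: "U_state n j q \<Longrightarrow> U_state n j (U_step n j q a)"
  by (cases q) auto

lemma D_state_step: "D_state j q \<Longrightarrow> D_state j (D_step j q a)"
  by (cases q) auto

lemma U_safe_id: "q \<noteq> Dead \<Longrightarrow> U_safe n id q"
  by (cases q) auto

lemma D_safe_id: "q \<noteq> Dead \<Longrightarrow> D_safe n id q"
  by (cases q) auto

text \<open>A violation for \<open>\<tau>\<close> at \<open>q\<close> is carried by
  \<open>s_a\<close> to a violation at the successor state.\<close>

lemma U_safe_pull_back: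
  assumes a: "1 \<le> a" "a < n" and desc: "\<tau> (Suc a) < \<tau> a"
    and q: "U_state n j q" and safe: "U_safe n (\<tau> \<circ> transpose a (Suc a)) (U_step n j q a)"
  shows "U_safe n \<tau> q"
proof (cases q)
  case (Healthy m)
  show ?thesis unfolding Healthy U_safe.simps
  proof (intro allI impI notI)
    fix i k assume ik: "1 \<le> i \<and> i < m \<and> m < k \<and> k \<le> n" and pat: "\<tau> m < \<tau> k \<and> \<tau> k < \<tau> i"
    consider "a = m" | "Suc a = m" | "a \<noteq> m" "Suc a \<noteq> m" by blast
    then show False
    proof cases
      case 1
      \<comment> \<open>The descent keeps \<open>Suc m\<close> from being the large value. After the
        exchange \<open>Suc m\<close> takes the place of \<open>m\<close> and forms the pattern with
        the same \<open>k\<close> and \<open>i\<close>.\<close>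
      then have "k \<noteq> Suc m" using desc pat by auto
      have "U_safe n (\<tau> \<circ> transpose a (Suc a)) (Healthy (Suc m))"
        using 1 safe q ik Healthy by auto
      from this[unfolded U_safe.simps, rule_format, of i k] show False
        using \<open>k \<noteq> Suc m\<close> 1 ik pat a by (auto simp: transpose_def split: if_splits)
    next
      case 2
      \<comment> \<open>Since \<open>s_{m-1}\<close> permutes \<open>{1..m}\<close>, the stability
        demanded by the ill state contradicts \<open>k\<close> standing before
        \<open>i\<close>.\<close>
      then have "U_safe n (\<tau> \<circ> transpose a (Suc a)) (Ill m)"
        using safe q ik Healthy by auto
      from this[unfolded U_safe.simps, rule_format, of "transpose a (Suc a) i" k] show False
        using 2 ik pat a
        by (auto simp: transpose_Suc_order)
    next
      case 3
      then have "U_safe n (\<tau> \<circ> transpose a (Suc a)) (Healthy m)"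
        using safe Healthy by (auto split: if_splits)
      from this[unfolded U_safe.simps, rule_format,
          of "transpose a (Suc a) i" "transpose a (Suc a) k"] show False
        using 3 ik pat a
        by (auto simp: transpose_Suc_order)
    qed
  qed
next
  case (Ill m)
  show ?thesis unfolding Ill U_safe.simps
  proof (intro allI impI)
    fix i k assume ik: "1 \<le> i \<and> i \<le> m \<and> m < k \<and> k \<le> n"
    have "a \<noteq> m"
      using safe q a Ill by auto
    then have "U_safe n (\<tau> \<circ> transpose a (Suc a)) (Ill m)"
      using safe Ill by (auto split: if_splits)
    from this[unfolded U_safe.simps, rule_format,
        of "transpose a (Suc a) i" "transpose a (Suc a) k"] show "\<tau> i < \<tau> k"
      using \<open>a \<noteq> m\<close> ik a
      by (auto simp: transpose_Suc_order)
  qed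
qed (use safe in simp)

text \<open>Mirror image of the previous lemma under \<open>x \<mapsto> n + 1 - x\<close> on values
  and positions, which exchanges the two patterns and turns \<open>s_a\<close> into
  \<open>s_{n-a}\<close>.\<close>

lemma D_safe_pull_back:
  assumes a: "1 \<le> a" "a < n" and desc: "\<tau> (Suc a) < \<tau> a"
    and q: "D_state j q" and safe: "D_safe n (\<tau> \<circ> transpose a (Suc a)) (D_step j q a)"
  shows "D_safe n \<tau> q"
proof (cases q)
  case (Healthy m)
  show ?thesis unfolding Healthy D_safe.simps
  proof (intro allI impI notI)
    fix i k assume ik: "1 \<le> i \<and> i < m \<and> m < k \<and> k \<le> n" and pat: "\<tau> k < \<tau> i \<and> \<tau> i < \<tau> m"
    consider "Suc a = m" | "a = m" | "a \<noteq> m" "Suc a \<noteq> m" by blast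
    then show False
    proof cases
      case 1
      then have "i \<noteq> a" using desc pat by auto
      have "D_safe n (\<tau> \<circ> transpose a (Suc a)) (Healthy a)"
        using 1 safe q ik a Healthy by auto
      from this[unfolded D_safe.simps, rule_format, of i k] show False
        using \<open>i \<noteq> a\<close> 1 ik pat a by (auto simp: transpose_def split: if_splits)
    next
      case 2
      then have "D_safe n (\<tau> \<circ> transpose a (Suc a)) (Ill m)"
        using safe q ik Healthy by auto
      from this[unfolded D_safe.simps, rule_format, of i "transpose a (Suc a) k"] show False
        using 2 ik pat a
        by (auto simp: transpose_Suc_order)
    next
      case 3
      then have "D_safe n (\<tau> \<circ> transpose a (Suc a)) (Healthy m)"
        using safe Healthy by (auto split: if_splits)
      from this[unfolded D_safe.simps, rule_format,
          of "transpose a (Suc a) i" "transpose a (Suc a) k"] show False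
        using 3 ik pat a
        by (auto simp: transpose_Suc_order)
    qed
  qed
next
  case (Ill m)
  show ?thesis unfolding Ill D_safe.simps
  proof (intro allI impI)
    fix i k assume ik: "1 \<le> i \<and> i < m \<and> m \<le> k \<and> k \<le> n"
    have "Suc a \<noteq> m"
      using safe q a Ill by auto
    then have "D_safe n (\<tau> \<circ> transpose a (Suc a)) (Ill m)"
      using safe Ill by (auto split: if_splits)
    from this[unfolded D_safe.simps, rule_format,
        of "transpose a (Suc a) i" "transpose a (Suc a) k"] show "\<tau> i < \<tau> k"
      using \<open>Suc a \<noteq> m\<close> ik a
      by (auto simp: transpose_Suc_order)
  qed
qed (use safe in simp)

text \<open>The premise \<open>free\<close> handles the one critical move, from
  \<open>Healthy (Suc a)\<close> to \<open>Ill (Suc a)\<close>, where avoidance alone does not give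
  stability.\<close>

lemma U_safe_push_forward:
  assumes a: "1 \<le> a" "a < n" and desc: "\<tau> (Suc a) < \<tau> a" and inj: "inj \<tau>"
    and safe: "U_safe n \<tau> q" and q: "U_state n j q"
    and free: "\<And>k. q = Healthy (Suc a) \<Longrightarrow> Suc a < k \<Longrightarrow> k \<le> n \<Longrightarrow> \<tau> (Suc a) < \<tau> k"
  shows "U_safe n (\<tau> \<circ> transpose a (Suc a)) (U_step n j q a)"
proof (cases q)
  case (Healthy m)
  have avoid: "\<not> (\<tau> m < \<tau> k \<and> \<tau> k < \<tau> i)" if "1 \<le> i" "i < m" "m < k" "k \<le> n" for i k
    using safe that unfolding Healthy by auto
  \<comment> \<open>By \<open>free\<close> the value \<open>m\<close> precedes each larger
    \<open>k\<close>; avoidance then forbids a smaller \<open>i\<close> after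
    \<open>k\<close>.\<close>
  have pres: "\<tau> i < \<tau> k" if "m = Suc a" "1 \<le> i" "i \<le> m" "m < k" "k \<le> n" for i k
    using that free[of k] injD[OF inj, of i k] avoid[of i k] Healthy
    by (cases "i = m") (auto simp: not_less le_less)
  \<comment> \<open>\<open>Healthy n\<close> is split off because it loops on \<open>s_{n-1}\<close>
    instead of falling ill.\<close>
  consider "a = m" | "Suc a = m" "m < n" | "Suc a = m" "m = n" | "a \<noteq> m" "Suc a \<noteq> m"
    using q Healthy by fastforce
  then show ?thesis
  proof cases
    case 1
    \<comment> \<open>The additional small value \<open>i = m\<close> now stands before
      \<open>Suc m\<close>, so it cannot end a pattern.\<close>
    have "\<not> (\<tau> m < \<tau> k \<and> \<tau> k < (\<tau> \<circ> transpose a (Suc a)) i)"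
      if "1 \<le> i" "i < Suc m" "Suc m < k" "k \<le> n" for i k
      using that 1 avoid[of i k] desc by (cases "i = m") auto
    then show ?thesis
      using 1 a q Healthy by auto
  next
    case 2
    have "(\<tau> \<circ> transpose a (Suc a)) i < \<tau> k" if "1 \<le> i" "i \<le> m" "m < k" "k \<le> n" for i k
      using that 2 a pres[of "transpose a (Suc a) i" k]
      by (auto simp: transpose_Suc_order)
    then show ?thesis
      using 2 q Healthy by auto
  next
    case 3
    then show ?thesis using Healthy by simp
  next
    case 4
    have "\<not> (\<tau> m < (\<tau> \<circ> transpose a (Suc a)) k \<and>
        (\<tau> \<circ> transpose a (Suc a)) k < (\<tau> \<circ> transpose a (Suc a)) i)"
      if "1 \<le> i" "i < m" "m < k" "k \<le> n" for i k
      using that 4 a avoid[of "transpose a (Suc a) i" "transpose a (Suc a) k"]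
      by (auto simp: transpose_Suc_order)
    then show ?thesis
      using 4 Healthy by auto
  qed
next
  case (Ill m)
  have pres: "\<tau> i < \<tau> k" if "1 \<le> i" "i \<le> m" "m < k" "k \<le> n" for i k
    using safe that unfolding Ill by auto
  \<comment> \<open>A descent at \<open>m\<close> would contradict stability, so the fatal letter is
    never the one read.\<close>
  have "a \<noteq> m"
    using pres[of a "Suc a"] a desc by auto
  have "(\<tau> \<circ> transpose a (Suc a)) i < (\<tau> \<circ> transpose a (Suc a)) k"
    if "1 \<le> i" "i \<le> m" "m < k" "k \<le> n" for i k
    using that \<open>a \<noteq> m\<close> a pres[of "transpose a (Suc a) i" "transpose a (Suc a) k"]
    by (auto simp: transpose_Suc_order)
  then show ?thesis
    using \<open>a \<noteq> m\<close> Ill by auto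
qed (use safe in simp)

text \<open>The mirror image again: the critical move leads from \<open>Healthy a\<close> to
  \<open>Ill a\<close>.\<close>

lemma D_safe_push_forward:
  assumes a: "1 \<le> a" "a < n" and desc: "\<tau> (Suc a) < \<tau> a" and inj: "inj \<tau>"
    and safe: "D_safe n \<tau> q" and q: "D_state j q" and j: "j \<le> n"
    and free: "\<And>i. q = Healthy a \<Longrightarrow> 1 \<le> i \<Longrightarrow> i < a \<Longrightarrow> \<tau> i < \<tau> a"
  shows "D_safe n (\<tau> \<circ> transpose a (Suc a)) (D_step j q a)"
proof (cases q)
  case (Healthy m)
  have avoid: "\<not> (\<tau> k < \<tau> i \<and> \<tau> i < \<tau> m)" if "1 \<le> i" "i < m" "m < k" "k \<le> n" for i k
    using safe that unfolding Healthy by auto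
  have pres: "\<tau> i < \<tau> k" if "m = a" "1 \<le> i" "i < m" "m \<le> k" "k \<le> n" for i k
    using that free[of i] injD[OF inj, of i k] avoid[of i k] Healthy
    by (cases "k = m") (auto simp: not_less le_less)
  \<comment> \<open>\<open>Healthy 1\<close> is split off as the looping state.\<close>
  consider "Suc a = m" | "a = m" "2 \<le> m" | "a = m" "m = 1" | "a \<noteq> m" "Suc a \<noteq> m"
    using q Healthy by fastforce
  then show ?thesis
  proof cases
    case 1
    have "\<not> ((\<tau> \<circ> transpose a (Suc a)) k < \<tau> i \<and> \<tau> i < \<tau> m)"
      if "1 \<le> i" "i < a" "a < k" "k \<le> n" for i k
      using that 1 avoid[of i k] desc by (cases "k = m") auto
    then show ?thesis
      using 1 a q Healthy by auto
  next
    case 2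
    have "\<tau> i < (\<tau> \<circ> transpose a (Suc a)) k" if "1 \<le> i" "i < m" "m \<le> k" "k \<le> n" for i k
      using that 2 a pres[of i "transpose a (Suc a) k"]
      by (auto simp: transpose_Suc_order)
    then show ?thesis
      using 2 q Healthy by auto
  next
    case 3
    then show ?thesis using Healthy by simp
  next
    case 4
    have "\<not> ((\<tau> \<circ> transpose a (Suc a)) k < (\<tau> \<circ> transpose a (Suc a)) i \<and>
        (\<tau> \<circ> transpose a (Suc a)) i < \<tau> m)"
      if "1 \<le> i" "i < m" "m < k" "k \<le> n" for i k
      using that 4 a avoid[of "transpose a (Suc a) i" "transpose a (Suc a) k"]
      by (auto simp: transpose_Suc_order)
    then show ?thesis
      using 4 Healthy by auto
  qed
next
  case (Ill m)
  have pres: "\<tau> i < \<tau> k" if "1 \<le> i" "i < m" "m \<le> k" "k \<le> n" for i k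
    using safe that unfolding Ill by auto
  have "Suc a \<noteq> m"
    using pres[of a "Suc a"] a desc by auto
  have "(\<tau> \<circ> transpose a (Suc a)) i < (\<tau> \<circ> transpose a (Suc a)) k"
    if "1 \<le> i" "i < m" "m \<le> k" "k \<le> n" for i k
    using that \<open>Suc a \<noteq> m\<close> a pres[of "transpose a (Suc a) i" "transpose a (Suc a) k"]
    by (auto simp: transpose_Suc_order)
  then show ?thesis
    using \<open>Suc a \<noteq> m\<close> Ill by auto
qed (use safe in simp)

section \<open>Runs of the automata on reduced words\<close>

lemma never_dead_iff:
  assumes "\<And>a. \<delta> Dead a = Dead"
  shows "never_dead \<delta> q w \<longleftrightarrow> foldl \<delta> q w \<noteq> Dead"
proof -
  \<comment> \<open>As \<open>Dead\<close> is absorbing, the state after the whole word decides for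
    all prefixes.\<close>
  have dead: "foldl \<delta> Dead v = Dead" for v
    by (induction v) (simp_all add: assms)
  have "foldl \<delta> q w = foldl \<delta> (foldl \<delta> q (take k w)) (drop k w)" for k
    by (metis append_take_drop_id foldl_append)
  then show ?thesis
    unfolding never_dead_def by (metis dead order_refl take_all)
qed

lemma U_accepts_iff: "U_accepts n j w \<longleftrightarrow> foldl (U_step n j) (Healthy j) w \<noteq> Dead"
  unfolding U_accepts_def by (rule never_dead_iff) simp

lemma D_accepts_iff: "D_accepts j w \<longleftrightarrow> foldl (D_step j) (Healthy j) w \<noteq> Dead"
  unfolding D_accepts_def by (rule never_dead_iff) simp

text \<open>At the end of the word \<open>id\<close> remains, for which every state but
  \<open>Dead\<close> is safe. Each letter is a descent of the permutation still to be read, so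
  safety is pulled back to the starting state.\<close>

lemma U_safe_if_run_not_dead:
  assumes "w \<in> words n" "length w = card (inversions n (inv (word_perm w)))"
    and "U_state n j q" "foldl (U_step n j) q w \<noteq> Dead"
  shows "U_safe n (inv (word_perm w)) q"
  using assms
proof (induction w arbitrary: q)
  case Nil
  then show ?case using U_safe_id[of q n] by (simp add: id_def)
next
  case (Cons a w)
  have "U_safe n (inv (word_perm w)) (U_step n j q a)"
    by (rule Cons.IH)
      (use Cons.prems first_letter_descent(2) U_state_step in \<open>auto simp del: word_perm_Cons\<close>)
  moreover have "inv (word_perm w) = inv (word_perm (a # w)) \<circ> transpose a (Suc a)"
    using Cons.prems by (simp add: inv_word_perm_Cons[of _ n] comp_assoc del: word_perm_Cons)
  ultimately have safe: "U_safe n (inv (word_perm (a # w)) \<circ> transpose a (Suc a)) (U_step n j q a)"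
    by (simp only:)
  show ?case
    by (rule U_safe_pull_back[OF _ _ first_letter_descent(1)[OF Cons.prems(1,2)] Cons.prems(3) safe])
      (use Cons.prems(1) in simp_all)
qed

lemma D_safe_if_run_not_dead:
  assumes "w \<in> words n" "length w = card (inversions n (inv (word_perm w)))"
    and "D_state j q" "foldl (D_step j) q w \<noteq> Dead"
  shows "D_safe n (inv (word_perm w)) q"
  using assms
proof (induction w arbitrary: q)
  case Nil
  then show ?case using D_safe_id[of q n] by (simp add: id_def)
next
  case (Cons a w)
  have "D_safe n (inv (word_perm w)) (D_step j q a)"
    by (rule Cons.IH)
      (use Cons.prems first_letter_descent(2) D_state_step in \<open>auto simp del: word_perm_Cons\<close>)
  moreover have "inv (word_perm w) = inv (word_perm (a # w)) \<circ> transpose a (Suc a)"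
    using Cons.prems by (simp add: inv_word_perm_Cons[of _ n] comp_assoc del: word_perm_Cons)
  ultimately have safe: "D_safe n (inv (word_perm (a # w)) \<circ> transpose a (Suc a)) (D_step j q a)"
    by (simp only:)
  show ?case
    by (rule D_safe_pull_back[OF _ _ first_letter_descent(1)[OF Cons.prems(1,2)] Cons.prems(3) safe])
      (use Cons.prems(1) in simp_all)
qed

section \<open>Existence of an accepted reduced word\<close>

text \<open>\<open>A\<close> and \<open>B\<close> stand for the indices of the current states
  \<open>H_m\<close> and \<open>G_m\<close>; the descent found can then be the next letter for all
  automata at once.\<close>

lemma unobstructed_descent:
  fixes \<tau> :: "nat \<Rightarrow> nat"
  assumes inj: "inj \<tau>" and disj: "A \<inter> B = {}"
    and A: "\<And>m. m \<in> A \<Longrightarrow> U_safe n \<tau> (Healthy m)"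
    and ex: "1 \<le> a0" "a0 < n" "\<tau> (Suc a0) < \<tau> a0"
  shows "\<exists>a. 1 \<le> a \<and> a < n \<and> \<tau> (Suc a) < \<tau> a
    \<and> (Suc a \<in> A \<longrightarrow> (\<forall>k. Suc a < k \<and> k \<le> n \<longrightarrow> \<tau> (Suc a) < \<tau> k))
    \<and> (a \<in> B \<longrightarrow> (\<forall>i. 1 \<le> i \<and> i < a \<longrightarrow> \<tau> i < \<tau> a))"
proof (rule ccontr)
  assume none: "\<not> ?thesis"
  define desc where "desc a \<longleftrightarrow> 1 \<le> a \<and> a < n \<and> \<tau> (Suc a) < \<tau> a" for a
  define U_free where
    "U_free a \<longleftrightarrow> (Suc a \<in> A \<longrightarrow> (\<forall>k. Suc a < k \<and> k \<le> n \<longrightarrow> \<tau> (Suc a) < \<tau> k))" for a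
  have lt: "\<tau> x < \<tau> y" if "\<not> \<tau> y < \<tau> x" "x \<noteq> y" for x y
    using that injD[OF inj, of x y] by linarith
  have "\<exists>a. desc a \<and> U_free a"
  proof -
    \<comment> \<open>The largest descent is unobstructed on the \<open>A\<close> side, because
      positions increase beyond it.\<close>
    define M where "M = (GREATEST a. desc a)"
    have bound: "\<forall>a. desc a \<longrightarrow> a \<le> n" by (simp add: desc_def)
    have "desc a0" using ex by (simp add: desc_def)
    then have M: "desc M"
      unfolding M_def using bound by (metis GreatestI_nat)
    have max: "a \<le> M" if "desc a" for a
      unfolding M_def using that bound by (metis Greatest_le_nat)
    have "U_free M"
      unfolding U_free_def
    proof (intro impI allI lt notI)
      fix k assume k: "Suc M < k \<and> k \<le> n" and "\<tau> k < \<tau> (Suc M)"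
      then obtain c where "Suc M \<le> c" "c < k" "\<tau> (Suc c) < \<tau> c"
        using descent_between[of "Suc M" k \<tau>] by auto
      then show False using max[of c] k by (simp add: desc_def)
    qed simp
    with M show ?thesis by blast
  qed
  \<comment> \<open>By minimality every descent below \<open>b\<close> is obstructed on the
    \<open>A\<close> side, while \<open>none\<close> makes \<open>b\<close> itself obstructed on the
    \<open>B\<close> side.\<close>
  then obtain b where b: "desc b" "U_free b"
    and least: "\<And>a. a < b \<Longrightarrow> desc a \<Longrightarrow> \<not> U_free a"
    using exists_least_iff[of "\<lambda>a. desc a \<and> U_free a"] by blast
  have "b \<in> B" "\<exists>i. 1 \<le> i \<and> i < b \<and> \<not> \<tau> i < \<tau> b"
    using none b by (auto simp: desc_def U_free_def)
  then obtain i where i: "1 \<le> i" "i < b" "\<tau> b < \<tau> i"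
    using lt by (metis less_irrefl)
  \<comment> \<open>The nearest descent below \<open>b\<close>; there is one because the smaller
    value \<open>i\<close> stands after \<open>b\<close>.\<close>
  define a where "a = (GREATEST a. desc a \<and> a < b)"
  obtain c where c: "i \<le> c" "c < b" "\<tau> (Suc c) < \<tau> c"
    using descent_between[OF i(2,3)] by blast
  then have "desc c \<and> c < b"
    using i b by (auto simp: desc_def)
  then have a: "desc a" "a < b"
    unfolding a_def using GreatestI_nat[of "\<lambda>a. desc a \<and> a < b" c b] by auto
  have gap: "x \<le> a" if "desc x" "x < b" for x
    unfolding a_def using that Greatest_le_nat[of "\<lambda>a. desc a \<and> a < b" x b] by auto
  have incr: "\<tau> x < \<tau> b" if "Suc a \<le> x" "x < b" for x
  proof (rule lt[OF notI])
    assume "\<tau> b < \<tau> x"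
    then obtain c where "x \<le> c" "c < b" "\<tau> (Suc c) < \<tau> c"
      using descent_between[of x b \<tau>] \<open>x < b\<close> by blast
    then show False
      using gap[of c] \<open>Suc a \<le> x\<close> b(1) by (simp add: desc_def)
  next
    show "x \<noteq> b" using that by simp
  qed
  have "Suc a \<in> A"
    using least[OF a(2,1)] by (auto simp: U_free_def)
  moreover from this have "Suc a < b"
    using disj \<open>b \<in> B\<close> a(2) by (metis IntI Suc_lessI empty_iff)
  moreover from this have "\<tau> (Suc a) < \<tau> b"
    using incr by simp
  \<comment> \<open>The values from \<open>Suc a\<close> up to \<open>b - 1\<close> stand before
    \<open>b\<close>, but \<open>i\<close> stands after it.\<close>
  moreover have "i < Suc a"
    using incr[of i] i by (meson not_less less_asym)
  moreover have "b \<le> n"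
    using b by (simp add: desc_def)
  \<comment> \<open>\<open>Suc a\<close>, \<open>b\<close>, \<open>i\<close> is the pattern
    forbidden at \<open>Healthy (Suc a)\<close>.\<close>
  ultimately show False
    using A[of "Suc a"] i by auto
qed

text \<open>Here \<open>u j\<close> and \<open>d j\<close> are the current states of \<open>U(j)\<close> and \<open>D(j)\<close>.\<close>

lemma accepted_word_exists:
  assumes "\<tau> permutes {1..n}"
    and "\<And>j. j \<in> U \<Longrightarrow> U_state n j (u j) \<and> U_safe n \<tau> (u j)"
    and "\<And>j. j \<in> D \<Longrightarrow> j < n \<and> D_state j (d j) \<and> D_safe n \<tau> (d j)"
    and "\<And>j l m. j \<in> U \<Longrightarrow> l \<in> D \<Longrightarrow> u j = Healthy m \<Longrightarrow> d l \<noteq> Healthy m"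
  shows "\<exists>w \<in> words n. inv (word_perm w) = \<tau> \<and> length w = card (inversions n \<tau>)
    \<and> (\<forall>j\<in>U. foldl (U_step n j) (u j) w \<noteq> Dead) \<and> (\<forall>j\<in>D. foldl (D_step j) (d j) w \<noteq> Dead)"
  using assms
\<comment> \<open>The states vary with \<open>\<tau>\<close>, since every letter chosen moves all
  automata.\<close>
proof (induction "card (inversions n \<tau>)" arbitrary: \<tau> u d rule: less_induct)
  case less
  note U = less.prems(2) and D = less.prems(3) and disj = less.prems(4)
  show ?case
  proof (cases "\<exists>a. 1 \<le> a \<and> a < n \<and> \<tau> (Suc a) < \<tau> a")
    case False
    then have "\<tau> = id"
      using permutes_no_descent_imp_id[OF less.prems(1)] by blast
    \<comment> \<open>The empty word keeps every current state, and a safe state is not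
      \<open>Dead\<close>.\<close>
    then show ?thesis
      using U D by (intro bexI[of _ "[]"]) force+
  next
    case True
    have inj: "inj \<tau>"
      using less.prems(1) by (rule permutes_inj)
    define A where "A = {m. \<exists>j\<in>U. u j = Healthy m}"
    define B where "B = {m. \<exists>j\<in>D. d j = Healthy m}"
    have "A \<inter> B = {}"
      using disj by (auto simp: A_def B_def)
    moreover have "U_safe n \<tau> (Healthy m)" if "m \<in> A" for m
      using that U by (force simp: A_def)
    ultimately obtain a where a: "1 \<le> a" "a < n" "\<tau> (Suc a) < \<tau> a"
      and freeA: "Suc a \<in> A \<longrightarrow> (\<forall>k. Suc a < k \<and> k \<le> n \<longrightarrow> \<tau> (Suc a) < \<tau> k)"
      and freeB: "a \<in> B \<longrightarrow> (\<forall>i. 1 \<le> i \<and> i < a \<longrightarrow> \<tau> i < \<tau> a)"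
      using unobstructed_descent[OF inj, of A B n] True by metis
    let ?\<sigma> = "\<tau> \<circ> transpose a (Suc a)"
    let ?u = "\<lambda>j. U_step n j (u j) a"
    let ?d = "\<lambda>j. D_step j (d j) a"
    have card: "card (inversions n \<tau>) = Suc (card (inversions n ?\<sigma>))"
      using a by (rule card_inversions_descent)
    have "\<exists>w \<in> words n. inv (word_perm w) = ?\<sigma> \<and> length w = card (inversions n ?\<sigma>)
      \<and> (\<forall>j\<in>U. foldl (U_step n j) (?u j) w \<noteq> Dead) \<and> (\<forall>j\<in>D. foldl (D_step j) (?d j) w \<noteq> Dead)"
    proof (rule less.hyps)
      show "card (inversions n ?\<sigma>) < card (inversions n \<tau>)"
        using card by simp
      show "?\<sigma> permutes {1..n}"
        using a less.prems(1) by (intro permutes_compose transpose_permutes_letter)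
      show "U_state n j (?u j) \<and> U_safe n ?\<sigma> (?u j)" if "j \<in> U" for j
        using U[OF that] that freeA a inj
        by (auto simp: A_def intro!: U_state_step U_safe_push_forward)
      show "j < n \<and> D_state j (?d j) \<and> D_safe n ?\<sigma> (?d j)" if "j \<in> D" for j
        using D[OF that] that freeB a inj
        by (auto simp: B_def intro!: D_state_step D_safe_push_forward)
      \<comment> \<open>New coincidences could arise only at \<open>a\<close> or
        \<open>Suc a\<close>. But \<open>H_a\<close> leaves \<open>a\<close> and
        \<open>G_{a+1}\<close> leaves \<open>Suc a\<close> on this same letter, so none
        does.\<close>
      show "?d l \<noteq> Healthy m" if "j \<in> U" "l \<in> D" "?u j = Healthy m" for j l m
        using that U[of j] D[of l] disj[of j l] a
        by (cases "u j"; cases "d l") (auto split: if_splits)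
    qed
    then obtain w where w: "w \<in> words n" "inv (word_perm w) = ?\<sigma>"
      "length w = card (inversions n ?\<sigma>)" "\<forall>j\<in>U. foldl (U_step n j) (?u j) w \<noteq> Dead"
      "\<forall>j\<in>D. foldl (D_step j) (?d j) w \<noteq> Dead" by blast
    have "inv (word_perm (a # w)) = \<tau>"
      using w by (simp add: inv_word_perm_Cons[of _ n] comp_assoc del: word_perm_Cons)
    then show ?thesis
      using w a card by (intro bexI[of _ "a # w"]) (auto simp del: word_perm_Cons)
  qed
qed

text \<open>The inversion number bounds all word lengths from below, and some word attains
  it.\<close>

lemma reduced_word_iff:
  assumes "\<pi> permutes {1..n}"
  shows "reduced_word n \<pi> w \<longleftrightarrow>
    w \<in> words n \<and> word_perm w = \<pi> \<and> length w = card (inversions n (inv \<pi>))"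
proof -
  \<comment> \<open>With no automata to satisfy, the existence lemma just yields a word of minimal
    length; the state functions are arbitrary.\<close>
  obtain v where v: "v \<in> words n" "inv (word_perm v) = inv \<pi>"
    "length v = card (inversions n (inv \<pi>))"
    using accepted_word_exists[of "inv \<pi>" n "{}" undefined "{}" undefined]
      permutes_inv[OF assms] by blast
  have "word_perm v = \<pi>"
    using v(2) permutes_inv_inv[OF assms] permutes_inv_inv[OF word_perm_permutes[OF v(1)]]
    by simp
  then show ?thesis
    unfolding reduced_word_def
    using v(1,3) card_inversions_le_length[of _ n] by (metis le_antisym)
qed

section \<open>Pattern avoidance\<close>

text \<open>Turns occurrences in one-line notation into comparisons of positions, the language of
  the safety predicates.\<close>

lemma appear_in_order_iff:
  assumes "\<pi> permutes {1..n}"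
  shows "appear_in_order n \<pi> x y z \<longleftrightarrow>
    {x, y, z} \<subseteq> {1..n} \<and> inv \<pi> x < inv \<pi> y \<and> inv \<pi> y < inv \<pi> z"
proof
  assume "appear_in_order n \<pi> x y z"
  then obtain p q r where "1 \<le> p" "p < q" "q < r" "r \<le> n" "\<pi> p = x" "\<pi> q = y" "\<pi> r = z"
    unfolding appear_in_order_def by blast
  then show "{x, y, z} \<subseteq> {1..n} \<and> inv \<pi> x < inv \<pi> y \<and> inv \<pi> y < inv \<pi> z"
    using permutes_in_image[OF assms, of p] permutes_in_image[OF assms, of q]
      permutes_in_image[OF assms, of r] permutes_inverses(2)[OF assms] by auto
next
  assume *: "{x, y, z} \<subseteq> {1..n} \<and> inv \<pi> x < inv \<pi> y \<and> inv \<pi> y < inv \<pi> z"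
  then have "inv \<pi> x \<in> {1..n}" "inv \<pi> z \<in> {1..n}"
    using permutes_in_image[OF permutes_inv[OF assms]] by auto
  then show "appear_in_order n \<pi> x y z"
    unfolding appear_in_order_def using * permutes_inverses(1)[OF assms]
    by (intro exI[of _ "inv \<pi> x"] exI[of _ "inv \<pi> y"] exI[of _ "inv \<pi> z"]) auto
qed

lemma avoids_jki_iff:
  assumes "\<pi> permutes {1..n}"
  shows "avoids_jki n \<pi> j \<longleftrightarrow> U_safe n (inv \<pi>) (Healthy j)"
  unfolding avoids_jki_def appear_in_order_iff[OF assms] by auto

lemma avoids_kij_iff:
  assumes "\<pi> permutes {1..n}"
  shows "avoids_kij n \<pi> j \<longleftrightarrow> D_safe n (inv \<pi>) (Healthy j)"
  unfolding avoids_kij_def appear_in_order_iff[OF assms] by auto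

theorem theorem4p29:
  fixes n :: nat and U D :: "nat set" and \<pi> :: "nat \<Rightarrow> nat"
  assumes "n \<ge> 3"
    and "U \<subseteq> {2..n - 1}" and "D \<subseteq> {2..n - 1}" and "U \<inter> D = {}"
    and "\<pi> permutes {1..n}"
  shows "(\<exists>w. reduced_word n \<pi> w \<and> (\<forall>j\<in>U. U_accepts n j w) \<and> (\<forall>j\<in>D. D_accepts j w))
     \<longleftrightarrow> (\<forall>j\<in>U. avoids_jki n \<pi> j) \<and> (\<forall>j\<in>D. avoids_kij n \<pi> j)"
    (is "?accepted \<longleftrightarrow> ?avoids")
proof
  assume ?accepted
  then obtain w where "w \<in> words n" "word_perm w = \<pi>" "length w = card (inversions n (inv \<pi>))"
    and acc: "\<forall>j\<in>U. U_accepts n j w" "\<forall>j\<in>D. D_accepts j w"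
    using reduced_word_iff[OF assms(5)] by blast
  then have "U_safe n (inv \<pi>) (Healthy j)" if "j \<in> U" for j
    using U_safe_if_run_not_dead[of w n j "Healthy j"] that assms(2) by (auto simp: U_accepts_iff)
  moreover have "D_safe n (inv \<pi>) (Healthy j)" if "j \<in> D" for j
    using D_safe_if_run_not_dead[of w n j "Healthy j"] that assms(3) acc
      \<open>w \<in> words n\<close> \<open>word_perm w = \<pi>\<close> \<open>length w = card (inversions n (inv \<pi>))\<close>
    by (auto simp: D_accepts_iff)
  ultimately show ?avoids
    unfolding avoids_jki_iff[OF assms(5)] avoids_kij_iff[OF assms(5)] by blast
next
  assume ?avoids
  then have safe: "\<And>j. j \<in> U \<Longrightarrow> U_safe n (inv \<pi>) (Healthy j)"
    "\<And>j. j \<in> D \<Longrightarrow> D_safe n (inv \<pi>) (Healthy j)"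
    unfolding avoids_jki_iff[OF assms(5)] avoids_kij_iff[OF assms(5)] by blast+
  have "\<exists>w \<in> words n. inv (word_perm w) = inv \<pi> \<and> length w = card (inversions n (inv \<pi>))
    \<and> (\<forall>j\<in>U. foldl (U_step n j) (Healthy j) w \<noteq> Dead)
    \<and> (\<forall>j\<in>D. foldl (D_step j) (Healthy j) w \<noteq> Dead)"
  proof (rule accepted_word_exists)
    show "inv \<pi> permutes {1..n}"
      using assms(5) by (rule permutes_inv)
    show "U_state n j (Healthy j) \<and> U_safe n (inv \<pi>) (Healthy j)" if "j \<in> U" for j
      using safe(1)[OF that] subsetD[OF assms(2) that] assms(1) by auto
    show "j < n \<and> D_state j (Healthy j) \<and> D_safe n (inv \<pi>) (Healthy j)" if "j \<in> D" for j
      using safe(2)[OF that] subsetD[OF assms(3) that] assms(1) by auto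
  \<comment> \<open>The initial states are \<open>Healthy j\<close>, so the separation of states is
    the disjointness of \<open>U\<close> and \<open>D\<close>.\<close>
  qed (use assms(4) in auto)
  then obtain w where w: "w \<in> words n" "inv (word_perm w) = inv \<pi>"
    "length w = card (inversions n (inv \<pi>))"
    "\<forall>j\<in>U. U_accepts n j w" "\<forall>j\<in>D. D_accepts j w"
    by (auto simp: U_accepts_iff D_accepts_iff)
  have "word_perm w = \<pi>"
    using w(2) permutes_inv_inv[OF assms(5)] permutes_inv_inv[OF word_perm_permutes[OF w(1)]]
    by simp
  then show ?accepted
    using w reduced_word_iff[OF assms(5)] by blast
qed

end
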